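(* Let $m,n$ be positive integers and let $\mathcal{T}_n^{(m)}$ be the $m$-Tamari lattice. Define the edge-labeling $\lambda:\mathcal{E}(\mathcal{T}_n^{(m)})\to\mathbb{N}\times\mathbb{N}$ by $\lambda(\mathbf{a},\mathbf{b})=(j,a_j)$, where $\mathbf{a}=(a_1,\ldots,a_n)$, $\mathbf{b}=(b_1,\ldots,b_n)$ and $j=\min\{i\in\{1,\ldots,n\}\mid a_i\ne b_i\}$. Equip $\mathbb{N}\times\mathbb{N}$ with the order $$(i,u)\le(j,v)\quad\text{if and only if}\quad i<j,\ \text{ or }\ i=j\text{ and }u\ge v.$$ Then $\lambda$ is an EL-labeling of $\mathcal{T}_n^{(m)}$ with respect to this order. Moreover, there is at most one falling maximal chain in each interval of $\mathcal{T}_n^{(m)}$.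
   Context: The lattice $\mathcal{T}_n^{(m)}$: let $\mathcal{D}_n^{(m)}$ be the set of all sequences $\mathbf{a}=(a_1,\ldots,a_n)$ of nonnegative integers with $a_1\le a_2\le\cdots\le a_n$ and $a_i\le m(i-1)$ for $1\le i\le n$. For $\mathbf{a}\in\mathcal{D}_n^{(m)}$ and $i\in\{1,\ldots,n\}$, the primitive subsequence of $\mathbf{a}$ at position $i$ is the unique subsequence $(a_i,a_{i+1},\ldots,a_k)$ such that $a_j-a_i<m(j-i)$ for all $i<j\le k$, and either $k=n$ or $a_{k+1}-a_i\ge m(k+1-i)$. For $\mathbf{a},\mathbf{a}'\in\mathcal{D}_n^{(m)}$ put $\mathbf{a}\lessdot\mathbf{a}'$ if and only if there is $i\in\{1,\ldots,n-1\}$ with $a_i<a_{i+1}$ and $\mathbf{a}'=(a_1,\ldots,a_i,a_{i+1}-1,a_{i+2}-1,\ldots,a_k-1,a_{k+1},\ldots,a_n)$, where $(a_{i+1},\ldots,a_k)$ is the primitive subsequence of $\mathbf{a}$ at position $i+1$. Let $\le$ be the reflexive and transitive closure of $\lessdot$. It is known that $(\mathcal{D}_n^{(m)},\le)$ is a lattice; it is the $m$-Tamari lattice $\mathcal{T}_n^{(m)}$. EL-labelings: for a poset $P$, let $\mathcal{E}(P)$ be the set of its covering relations. An edge-labeling of $P$ is a map $\lambda:\mathcal{E}(P)\to\Lambda$ to some poset $\Lambda$. A maximal chain $c:x=p_0\lessdot p_1\lessdot\cdots\lessdot p_s=y$ in an interval $[x,y]$ has label sequence $\lambda(c)=(\lambda(p_0,p_1),\ldots,\lambda(p_{s-1},p_s))$;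 it is rising if $\lambda(c)$ is strictly increasing, and falling if $\lambda(c)$ is weakly decreasing. Label sequences are compared lexicographically: $(p_1,\ldots,p_s)\le(q_1,\ldots,q_t)$ if and only if either $s\le t$ and $p_i=q_i$ for $1\le i\le s$, or $p_i<q_i$ for the least $i$ with $p_i\ne q_i$. $\lambda$ is an EL-labeling if every non-singleton interval $[x,y]$ of $P$ has a unique rising maximal chain and this chain is lexicographically first among all maximal chains of $[x,y]$. *)

theory Defs
  imports Main
begin

text \<open>
  A poset with carrier \<open>A\<close> is given by its order relation \<open>r\<close> with
  \<^prop>\<open>partial_order_on A r\<close>; \<open>(x, y) \<in> r\<close> means that \<open>x\<close> is less than or equal to \<open>y\<close>.
\<close>

definition covers :: "('a \<times> 'a) set \<Rightarrow> 'a \<Rightarrow> 'a \<Rightarrow> bool" where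
  "covers r x y \<longleftrightarrow>
     (x, y) \<in> r \<and> x \<noteq> y \<and> \<not> (\<exists>z. (x, z) \<in> r \<and> (z, y) \<in> r \<and> z \<noteq> x \<and> z \<noteq> y)"

text \<open>Maximal chains of the interval \<open>[x, y]\<close>, listed from bottom to top, both ends included.\<close>

definition maximal_chain :: "('a \<times> 'a) set \<Rightarrow> 'a \<Rightarrow> 'a \<Rightarrow> 'a list \<Rightarrow> bool" where
  "maximal_chain r x y c \<longleftrightarrow>
     c \<noteq> [] \<and> hd c = x \<and> last c = y \<and> (\<forall>i. Suc i < length c \<longrightarrow> covers r (c ! i) (c ! Suc i))"

text \<open>
  An edge-labeling is a function of two arguments; its values outside the covering
  relations are never used.
\<close>

definition labels :: "('a \<Rightarrow> 'a \<Rightarrow> 'l) \<Rightarrow> 'a list \<Rightarrow> 'l list" where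
  "labels lam c = map (\<lambda>i. lam (c ! i) (c ! Suc i)) [0..<length c - 1]"

definition rising :: "('l \<times> 'l) set \<Rightarrow> ('a \<Rightarrow> 'a \<Rightarrow> 'l) \<Rightarrow> 'a list \<Rightarrow> bool" where
  "rising s lam c \<longleftrightarrow> sorted_wrt (\<lambda>u v. (u, v) \<in> s \<and> u \<noteq> v) (labels lam c)"

definition falling :: "('l \<times> 'l) set \<Rightarrow> ('a \<Rightarrow> 'a \<Rightarrow> 'l) \<Rightarrow> 'a list \<Rightarrow> bool" where
  "falling s lam c \<longleftrightarrow> sorted_wrt (\<lambda>u v. (v, u) \<in> s) (labels lam c)"

text \<open>\<^const>\<open>lexord\<close> expects the strict order on letters and contains the proper prefixes.\<close>

definition lex_le :: "('l \<times> 'l) set \<Rightarrow> 'l list \<Rightarrow> 'l list \<Rightarrow> bool" where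
  "lex_le s ps qs \<longleftrightarrow> (ps, qs) \<in> (lexord (s - Id))\<^sup>="

definition EL_labeling ::
  "'a set \<Rightarrow> ('a \<times> 'a) set \<Rightarrow> ('l \<times> 'l) set \<Rightarrow> ('a \<Rightarrow> 'a \<Rightarrow> 'l) \<Rightarrow> bool" where
  "EL_labeling A r s lam \<longleftrightarrow>
     partial_order_on A r \<and> partial_order_on UNIV s \<and>
     (\<forall>x y. (x, y) \<in> r \<and> x \<noteq> y \<longrightarrow>
        (\<exists>!c. maximal_chain r x y c \<and> rising s lam c) \<and>
        (\<forall>c d. maximal_chain r x y c \<and> rising s lam c \<and> maximal_chain r x y d \<longrightarrow>
           lex_le s (labels lam c) (labels lam d)))"

text \<open>
  A sequence \<open>(a\<^sub>1, \<dots>, a\<^sub>n)\<close> is a list of length \<open>n\<close>; \<open>a\<llangle>i\<rrangle>\<close> is its entry \<open>a\<^sub>i\<close>, with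
  positions counted from 1.
\<close>

abbreviation entry :: "'a list \<Rightarrow> nat \<Rightarrow> 'a" (\<open>_\<llangle>_\<rrangle>\<close> [1000, 0] 1000) where
  "a\<llangle>i\<rrangle> \<equiv> a ! (i - 1)"

definition Dyck :: "nat \<Rightarrow> nat \<Rightarrow> nat list set" where
  "Dyck m n =
     {a. length a = n \<and>
         (\<forall>i \<in> {1..<n}. a\<llangle>i\<rrangle> \<le> a\<llangle>i + 1\<rrangle>) \<and>
         (\<forall>i \<in> {1..n}. a\<llangle>i\<rrangle> \<le> m * (i - 1))}"

text \<open>
  \<open>(a\<^sub>i, \<dots>, a\<^sub>k)\<close> is the primitive subsequence of \<open>a\<close> at position \<open>i\<close>. The subtraction
  \<open>a\<^sub>j - a\<^sub>i\<close> does not truncate, since the entries of members of \<open>Dyck m n\<close> increase weakly.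
\<close>

definition primitive_end :: "nat \<Rightarrow> nat list \<Rightarrow> nat \<Rightarrow> nat \<Rightarrow> bool" where
  "primitive_end m a i k \<longleftrightarrow>
     i \<le> k \<and> k \<le> length a \<and>
     (\<forall>j. i < j \<and> j \<le> k \<longrightarrow> a\<llangle>j\<rrangle> - a\<llangle>i\<rrangle> < m * (j - i)) \<and>
     (k = length a \<or> a\<llangle>k + 1\<rrangle> - a\<llangle>i\<rrangle> \<ge> m * (k + 1 - i))"

lemma primitive_end_unique:
  assumes "primitive_end m a i k" "primitive_end m a i l"
  shows "k = l"
proof -
  have "\<not> k < l" if "primitive_end m a i k" "primitive_end m a i l" for k l
  proof
    assume "k < l"
    then have "a\<llangle>k + 1\<rrangle> - a\<llangle>i\<rrangle> < m * (k + 1 - i)"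
      using that unfolding primitive_end_def by (metis Suc_eq_plus1 Suc_leI le_imp_less_Suc)
    moreover have "k \<noteq> length a"
      using \<open>k < l\<close> that(2) unfolding primitive_end_def by auto
    ultimately show False
      using that(1) unfolding primitive_end_def by auto
  qed
  then show ?thesis
    using assms by (metis linorder_neqE_nat)
qed

lemma primitive_end_exists:
  assumes "i \<le> length a"
  shows "\<exists>k. primitive_end m a i k"
proof -
  define P where
    "P k \<longleftrightarrow> i \<le> k \<and> (k = length a \<or> a\<llangle>k + 1\<rrangle> - a\<llangle>i\<rrangle> \<ge> m * (k + 1 - i))" for k
  have len: "P (length a)"
    using assms by (simp add: P_def)
  define k where "k = (LEAST k. P k)"
  have k: "P k" "k \<le> length a"
    unfolding k_def using len by (auto intro: LeastI Least_le)
  have "a\<llangle>j\<rrangle> - a\<llangle>i\<rrangle> < m * (j - i)" if j: "i < j" "j \<le> k" for j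
  proof -
    have "\<not> P (j - 1)"
      unfolding k_def using j not_less_Least[of "j - 1" P] k_def by auto
    then show ?thesis
      using j unfolding P_def by auto
  qed
  then show ?thesis
    using k unfolding primitive_end_def P_def by blast
qed

definition tamari_step :: "nat \<Rightarrow> nat \<Rightarrow> (nat list \<times> nat list) set" where
  "tamari_step m n =
     {(a, a'). a \<in> Dyck m n \<and> a' \<in> Dyck m n \<and>
        (\<exists>i \<in> {1..<n}. \<exists>k. a\<llangle>i\<rrangle> < a\<llangle>i + 1\<rrangle> \<and> primitive_end m a (i + 1) k \<and>
           a' = map (\<lambda>j. if i + 1 \<le> j \<and> j \<le> k then a\<llangle>j\<rrangle> - 1 else a\<llangle>j\<rrangle>) [1..<n + 1])}"

text \<open>The closure is restricted to the carrier, as \<^const>\<open>rtrancl\<close> is reflexive on all lists.\<close>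

definition tamari :: "nat \<Rightarrow> nat \<Rightarrow> (nat list \<times> nat list) set" where
  "tamari m n = Restr ((tamari_step m n)\<^sup>*) (Dyck m n)"

definition label_order :: "((nat \<times> nat) \<times> (nat \<times> nat)) set" where
  "label_order = {((i, u), (j, v)). i < j \<or> i = j \<and> u \<ge> v}"

definition tamari_label :: "nat \<Rightarrow> nat list \<Rightarrow> nat list \<Rightarrow> nat \<times> nat" where
  "tamari_label n a b = (let j = Min {i \<in> {1..n}. a\<llangle>i\<rrangle> \<noteq> b\<llangle>i\<rrangle>} in (j, a\<llangle>j\<rrangle>))"

lemma partial_order_on_label_order: "partial_order_on UNIV label_order"
  unfolding partial_order_on_def preorder_on_def label_order_def
  by (auto intro!: refl_onI transI antisymI)

lemma tamari_step_le:
  assumes "(a, b) \<in> tamari_step m n"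
  shows "list_all2 (\<le>) b a"
proof -
  have "length a = n"
    using assms by (auto simp: tamari_step_def Dyck_def)
  then show ?thesis
    using assms by (auto simp: tamari_step_def list_all2_conv_all_nth simp del: upt_Suc)
qed

lemma partial_order_on_tamari: "partial_order_on (Dyck m n) (tamari m n)"
proof -
  have le: "list_all2 (\<le>) b a" if "(a, b) \<in> (tamari_step m n)\<^sup>*" for a b
    using that
  proof (induction rule: rtrancl_induct)
    case base
    show ?case by (simp add: list_all2_conv_all_nth)
  next
    case (step b c)
    then show ?case
      using tamari_step_le list_all2_trans[of "(\<le>)" "(\<le>)" "(\<le>)"] by (metis le_trans)
  qed
  have "antisym (tamari m n)"
  proof (rule antisymI)
    fix a b assume "(a, b) \<in> tamari m n" "(b, a) \<in> tamari m n"
    then have "list_all2 (\<le>) b a" "list_all2 (\<le>) a b"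
      using le by (auto simp: tamari_def)
    then show "a = b"
      by (simp add: list_all2_conv_all_nth list_eq_iff_nth_eq order_antisym)
  qed
  moreover have "trans (tamari m n)"
    unfolding tamari_def by (auto intro!: transI)
  moreover have "refl_on (Dyck m n) (tamari m n)"
    unfolding tamari_def by (auto intro!: refl_onI)
  ultimately show ?thesis
    unfolding partial_order_on_def preorder_on_def by (auto simp: tamari_def)
qed

end

theory Submission
  imports Defs
begin

text \<open>
  Write \<open>S\<^sub>p x\<close> for the result of the step that lowers the primitive subsequence of \<open>x\<close>
  at position \<open>p\<close>. A step is determined by its source and its position, it changes no
  entry before \<open>p\<close>, and it decreases the entry at \<open>p\<close> by one; entries never grow along a
  chain. Its label is \<open>(p, x\<^sub>p)\<close>. Since \<open>x\<^sub>p\<close> decreases whenever \<open>p\<close> is used, two steps of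
  a chain at the same position have strictly increasing labels. So a chain is rising if and
  only if its positions increase weakly, and falling if and only if they decrease strictly.

  Everything rests on one confluence property (\<open>step_exchange\<close>): if \<open>p < i\<close> and both
  \<open>S\<^sub>p\<close> and \<open>S\<^sub>i\<close> apply to \<open>x\<close>, then \<open>S\<^sub>p x\<close> is strictly below \<open>S\<^sub>p (S\<^sub>i x)\<close>. The
  two steps commute unless the block of \<open>p\<close> ends right before \<open>i\<close> and is joined to the
  block of \<open>i\<close> by the step at \<open>i\<close>; in that case
  \<open>S\<^sub>p (S\<^sub>i x) = S\<^sub>i (S\<^sub>i (S\<^sub>p x))\<close>. Pushing a step at \<open>p\<close> to the front of a chain in
  this way gives \<open>lower_first_diff\<close>: if \<open>x < y\<close> and \<open>p\<close> is the first position where \<open>x\<close>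
  and \<open>y\<close> differ, then \<open>S\<^sub>p x \<le> y\<close>. The same property shows that each step is a
  covering relation, so that maximal chains are sequences of steps.

  Every maximal chain from \<open>x\<close> to \<open>y\<close> uses only positions from \<open>p\<close> on, and it uses \<open>p\<close>.
  A rising chain therefore has to start with \<open>S\<^sub>p\<close>, which it can by \<open>lower_first_diff\<close>;
  iterating this produces the chain, shows that it is unique, and shows that it is
  lexicographically first, since a chain that departs from it takes a step at a later
  position. A falling chain, on the other hand, has to end with a step at \<open>p\<close>. The
  block of \<open>p\<close> is the same before and after this step (\<open>block_lower_self\<close>), so \<open>y\<close>
  and \<open>p\<close> determine the last but one element, and by iteration the whole chain.
\<close>

section \<open>Blocks and heights\<close>

text \<open>
  From here on positions are list indices, counted from 0. The position \<open>p\<close> of a step is the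
  index of the first entry that is lowered, so its label is \<open>(Suc p, a ! p)\<close>.
\<close>

lemma Dyck_iff:
  "a \<in> Dyck m n \<longleftrightarrow>
     length a = n \<and> (\<forall>i. Suc i < n \<longrightarrow> a ! i \<le> a ! Suc i) \<and> (\<forall>i<n. a ! i \<le> m * i)"
proof -
  have "(\<forall>i \<in> {1..<n}. a ! (i - 1) \<le> a ! (i + 1 - 1)) \<longleftrightarrow> (\<forall>i. Suc i < n \<longrightarrow> a ! i \<le> a ! Suc i)"
    by (auto simp: Ball_def) (metis One_nat_def Suc_le_eq Suc_pred)
  moreover have "(\<forall>i \<in> {1..n}. a ! (i - 1) \<le> m * (i - 1)) \<longleftrightarrow> (\<forall>i<n. a ! i \<le> m * i)"
  proof (intro iffI ballI allI impI)
    fix i assume *: "\<forall>i \<in> {1..n}. a ! (i - 1) \<le> m * (i - 1)" "i < n"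
    show "a ! i \<le> m * i"
      using bspec[OF *(1), of "Suc i"] *(2) by simp
  qed auto
  ultimately show ?thesis
    unfolding Dyck_def by auto
qed

lemma Dyck_mono:
  assumes "a \<in> Dyck m n" "i \<le> j" "j < n"
  shows "a ! i \<le> a ! j"
  using assms(2,3)
proof (induction j rule: dec_induct)
  case (step j)
  then have "a ! i \<le> a ! j" "a ! j \<le> a ! Suc j"
    using assms(1) by (auto simp: Dyck_iff)
  then show ?case by linarith
qed simp

text \<open>
  Heights linearise the conditions on a primitive subsequence: the inequality
  \<open>a\<^sub>j - a\<^sub>p < m * (j - p)\<close> says that \<open>j\<close> is higher than \<open>p\<close>. Integers avoid truncation.
\<close>

definition height :: "nat \<Rightarrow> nat list \<Rightarrow> nat \<Rightarrow> int" where
  "height m a j = int (m * j) - int (a ! j)"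

text \<open>
  The primitive subsequence at \<open>p\<close> occupies the indices from \<open>p\<close> to \<open>q - 1\<close>: it is the
  maximal run after \<open>p\<close> of positions higher than \<open>p\<close>. Two such runs are nested or
  disjoint.
\<close>

definition block :: "nat \<Rightarrow> nat list \<Rightarrow> nat \<Rightarrow> nat \<Rightarrow> bool" where
  "block m a p q \<longleftrightarrow>
     p < q \<and> q \<le> length a \<and> (\<forall>j. p < j \<and> j < q \<longrightarrow> height m a p < height m a j) \<and>
     (q < length a \<longrightarrow> height m a q \<le> height m a p)"

lemma height_less_iff:
  assumes "a \<in> Dyck m n" "p \<le> j" "j < n"
  shows "height m a p < height m a j \<longleftrightarrow> a ! j - a ! p < m * (j - p)"
proof -
  have "m * p \<le> m * j" using assms(2) by simp
  then show ?thesis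
    using Dyck_mono[OF assms] unfolding height_def diff_mult_distrib2 by linarith
qed

lemma primitive_end_iff_block:
  assumes "a \<in> Dyck m n" "p < n"
  shows "primitive_end m a (p + 1) q \<longleftrightarrow> block m a p q"
proof -
  have len: "length a = n" using assms by (simp add: Dyck_iff)
  have "(\<forall>j. p + 1 < j \<and> j \<le> q \<longrightarrow> a ! (j - 1) - a ! p < m * (j - (p + 1))) \<longleftrightarrow>
        (\<forall>j. p < j \<and> j < q \<longrightarrow> height m a p < height m a j)" (is "?L = ?R") if "q \<le> n"
  proof
    assume L: ?L
    show ?R
    proof (intro allI impI)
      fix j assume j: "p < j \<and> j < q"
      then show "height m a p < height m a j"
        using L[rule_format, of "Suc j"] height_less_iff[OF assms(1), of p j] that by simp
    qed
  next
    assume R: ?R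
    show ?L
    proof (intro allI impI)
      fix j assume j: "p + 1 < j \<and> j \<le> q"
      then have k: "p < j - 1" "j - 1 < q" "j - 1 < n" "j - 1 - p = j - (p + 1)"
        using that by auto
      then show "a ! (j - 1) - a ! p < m * (j - (p + 1))"
        using R[rule_format, OF conjI[OF k(1,2)]] height_less_iff[OF assms(1), of p "j - 1"]
        by simp
    qed
  qed
  moreover have "a ! q - a ! p \<ge> m * (q - p) \<longleftrightarrow> height m a q \<le> height m a p"
    if "p < q" "q < n"
    using height_less_iff[OF assms(1), of p q] that by linarith
  ultimately show ?thesis
    unfolding primitive_end_def block_def len by auto
qed

lemma block_unique:
  assumes "block m a p q" "block m a p r"
  shows "q = r"
proof -
  have "\<not> q < r" if "block m a p q" "block m a p r" for q r
    using that unfolding block_def by force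
  then show ?thesis using assms by (metis linorder_neqE_nat)
qed

lemma block_exists:
  assumes "a \<in> Dyck m n" "p < n"
  shows "\<exists>q. block m a p q"
  using primitive_end_exists[of "p + 1" a m] primitive_end_iff_block[OF assms] assms
  by (auto simp: Dyck_iff)

section \<open>Steps of the Tamari order\<close>

definition lower :: "nat \<Rightarrow> nat \<Rightarrow> nat list \<Rightarrow> nat list" where
  "lower p q a = map (\<lambda>j. if p \<le> j \<and> j < q then a ! j - 1 else a ! j) [0..<length a]"

text \<open>
  The positions at which a step is possible. Lowering from an ascent on keeps the sequence
  weakly increasing, and all entries from there on are positive.
\<close>

definition ascent :: "nat list \<Rightarrow> nat \<Rightarrow> bool" where
  "ascent a p \<longleftrightarrow> 0 < p \<and> p < length a \<and> a ! (p - 1) < a ! p"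

definition step_at :: "nat \<Rightarrow> nat \<Rightarrow> nat \<Rightarrow> nat list \<Rightarrow> nat list \<Rightarrow> bool" where
  "step_at m n p a b \<longleftrightarrow> a \<in> Dyck m n \<and> ascent a p \<and> (\<exists>q. block m a p q \<and> b = lower p q a)"

lemma length_lower [simp]: "length (lower p q a) = length a"
  by (simp add: lower_def)

lemma nth_lower:
  "j < length a \<Longrightarrow> lower p q a ! j = (if p \<le> j \<and> j < q then a ! j - 1 else a ! j)"
  by (simp add: lower_def)

lemma ascent_pos:
  assumes "a \<in> Dyck m n" "ascent a p" "p \<le> j" "j < n"
  shows "0 < a ! j"
  using Dyck_mono[OF assms(1,3,4)] assms(2) by (auto simp: ascent_def)

lemma height_lower:
  assumes "a \<in> Dyck m n" "ascent a p" "j < n"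
  shows "height m (lower p q a) j = height m a j + (if p \<le> j \<and> j < q then 1 else 0)"
  using ascent_pos[OF assms(1,2), of j] assms(1,3)
  by (auto simp: height_def nth_lower Dyck_iff of_nat_diff)

lemma lower_in_Dyck:
  assumes "a \<in> Dyck m n" "ascent a p"
  shows "lower p q a \<in> Dyck m n"
proof -
  have len: "length a = n" and mono: "\<And>i. Suc i < n \<Longrightarrow> a ! i \<le> a ! Suc i"
    and bound: "\<And>i. i < n \<Longrightarrow> a ! i \<le> m * i"
    using assms by (auto simp: Dyck_iff)
  have "lower p q a ! i \<le> lower p q a ! Suc i" if "Suc i < n" for i
    using mono[OF that] assms(2) that len
    by (cases "p = Suc i") (auto simp: nth_lower ascent_def)
  moreover have "lower p q a ! i \<le> m * i" if "i < n" for i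
    using bound[OF that] that len by (auto simp: nth_lower)
  ultimately show ?thesis
    using len by (auto simp: Dyck_iff)
qed

lemma step_at_in_Dyck:
  "step_at m n p a b \<Longrightarrow> a \<in> Dyck m n \<and> b \<in> Dyck m n"
  unfolding step_at_def using lower_in_Dyck by blast

lemma tamari_step_iff: "(a, b) \<in> tamari_step m n \<longleftrightarrow> (\<exists>p. step_at m n p a b)"
proof -
  have lower_eq: "map (\<lambda>j. if i + 1 \<le> j \<and> j \<le> k then a\<llangle>j\<rrangle> - 1 else a\<llangle>j\<rrangle>) [1..<n + 1] = lower i k a"
    if "length a = n" for i k
    by (rule nth_equalityI) (use that in \<open>auto simp: nth_lower simp del: upt_Suc\<close>)
  show ?thesis
  proof
    assume "(a, b) \<in> tamari_step m n"
    then obtain i k where *: "a \<in> Dyck m n" "i \<in> {1..<n}" "a\<llangle>i\<rrangle> < a\<llangle>i + 1\<rrangle>"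
        "primitive_end m a (i + 1) k"
        "b = map (\<lambda>j. if i + 1 \<le> j \<and> j \<le> k then a\<llangle>j\<rrangle> - 1 else a\<llangle>j\<rrangle>) [1..<n + 1]"
      unfolding tamari_step_def by blast
    have len: "length a = n" using *(1) by (simp add: Dyck_iff)
    have "block m a i k" using * primitive_end_iff_block[of a m n i k] by simp
    moreover have "b = lower i k a" unfolding *(5) by (rule lower_eq[OF len])
    ultimately have "step_at m n i a b"
      using * len unfolding step_at_def ascent_def by auto
    then show "\<exists>p. step_at m n p a b" ..
  next
    assume "\<exists>p. step_at m n p a b"
    then obtain p where p: "step_at m n p a b" ..
    then obtain q where *: "a \<in> Dyck m n" "ascent a p" "block m a p q" "b = lower p q a"
      unfolding step_at_def by blast
    have len: "length a = n" using *(1) by (simp add: Dyck_iff)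
    have "primitive_end m a (p + 1) q"
      using * len primitive_end_iff_block[of a m n p q] by (simp add: ascent_def)
    moreover have "b \<in> Dyck m n" using step_at_in_Dyck[OF p] by simp
    moreover have "p \<in> {1..<n}" "a\<llangle>p\<rrangle> < a\<llangle>p + 1\<rrangle>"
      using *(2) len by (auto simp: ascent_def)
    ultimately show "(a, b) \<in> tamari_step m n"
      unfolding tamari_step_def mem_Collect_eq prod.case
      using *(1,4) lower_eq[OF len, of p q, symmetric] by blast
  qed
qed

lemma step_at_tamari_step: "step_at m n p a b \<Longrightarrow> (a, b) \<in> tamari_step m n"
  using tamari_step_iff by blast

lemma step_at_exists:
  assumes "a \<in> Dyck m n" "ascent a p"
  shows "\<exists>b. step_at m n p a b"
  using assms block_exists[OF assms(1), of p] unfolding step_at_def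
  by (auto simp: ascent_def Dyck_iff)

lemma step_at_unique: "step_at m n p a b \<Longrightarrow> step_at m n p a c \<Longrightarrow> b = c"
  unfolding step_at_def using block_unique by blast

lemma step_at_nth_before:
  assumes "step_at m n p a b" "j < p"
  shows "b ! j = a ! j"
  using assms by (auto simp: step_at_def ascent_def nth_lower)

lemma step_at_nth_at:
  assumes "step_at m n p a b"
  shows "b ! p < a ! p" "p < n"
  using assms by (auto simp: step_at_def ascent_def nth_lower block_def Dyck_iff)

text \<open>
  Lowering a block raises its heights uniformly by one and leaves the next height alone.
\<close>

lemma block_lower_self:
  assumes "a \<in> Dyck m n" "ascent a p" "block m a p q"
  shows "block m (lower p q a) p q"
proof -
  have len: "length a = n" using assms(1) by (simp add: Dyck_iff)
  have "height m (lower p q a) j = height m a j + (if p \<le> j \<and> j < q then 1 else 0)"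
    if "j < n" for j by (rule height_lower[OF assms(1,2) that])
  then show ?thesis
    using assms(3) len unfolding block_def by auto
qed

text \<open>
  The step at \<open>i\<close> raises the heights on the block \<open>{i..<r}\<close> of \<open>i\<close> by one. This affects the
  block \<open>{p..<q}\<close> of \<open>p < i\<close> only if \<open>q = i\<close> and \<open>p\<close> and \<open>i\<close> have equal height: then
  \<open>i\<close> becomes higher than \<open>p\<close>, and the block of \<open>p\<close> extends to \<open>r\<close>.
\<close>

lemma step_exchange:
  assumes a: "step_at m n i a b" and pi: "p < i" and asc: "ascent a p"
  shows "\<exists>c d. step_at m n p a c \<and> step_at m n p b d \<and> (c, d) \<in> (tamari_step m n)\<^sup>+"
proof -
  obtain r where aD: "a \<in> Dyck m n" and asci: "ascent a i" and r: "block m a i r"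
    and b: "b = lower i r a"
    using a unfolding step_at_def by blast
  have len: "length a = n" using aD by (simp add: Dyck_iff)
  obtain q where q: "block m a p q"
    using block_exists[OF aD] asc len by (auto simp: ascent_def)
  define c where "c = lower p q a"
  have step_c: "step_at m n p a c"
    unfolding step_at_def c_def using aD asc q by blast
  have bD: "b \<in> Dyck m n" and cD: "c \<in> Dyck m n"
    using step_at_in_Dyck a step_c by auto
  have hb: "height m b j = height m a j + (if i \<le> j \<and> j < r then 1 else 0)" if "j < n" for j
    unfolding b by (rule height_lower[OF aD asci that])
  have hc: "height m c j = height m a j + (if p \<le> j \<and> j < q then 1 else 0)" if "j < n" for j
    unfolding c_def by (rule height_lower[OF aD asc that])
  have lens: "length b = n" "length c = n" by (simp_all add: b c_def len)
  have asc_b: "ascent b p"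
    using asc pi len by (auto simp: ascent_def b nth_lower)
  have pos: "0 < a ! j" if "p \<le> j" "j < n" for j
    using ascent_pos[OF aD asc that] .
  have inb: "i < n" using asci len by (simp add: ascent_def)
  have prev: "a ! (i - 1) < a ! i" "0 < a ! (i - 1)" "p \<le> i - 1" "i - 1 < i" "0 < i"
    using asci pi pos[of "i - 1"] inb by (auto simp: ascent_def)
  then have asc_c: "ascent c i"
    using inb len prev by (auto simp: ascent_def c_def nth_lower)
  have qb: "p < q" "q \<le> n" "i < r" "r \<le> n" using q r len by (auto simp: block_def)
  have qin: "\<And>j. p < j \<Longrightarrow> j < q \<Longrightarrow> height m a p < height m a j"
    and qend: "q < n \<Longrightarrow> height m a q \<le> height m a p"
    and rin: "\<And>j. i < j \<Longrightarrow> j < r \<Longrightarrow> height m a i < height m a j"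
    and rend: "r < n \<Longrightarrow> height m a r \<le> height m a i"
    using q r len by (auto simp: block_def)
  show ?thesis
  \<comment> \<open>The first case is the one in which the blocks merge.\<close>
  proof (cases "i = q \<and> height m a i = height m a p")
    case True
    then have iq: "i = q" and eq: "height m a q = height m a p" by auto
    have "block m b p r"
      unfolding block_def lens
    proof (intro conjI allI impI)
      fix j assume j: "p < j \<and> j < r"
      then have "height m a p < height m b j"
      proof (cases "j < q")
        case True then show ?thesis using j qin[of j] hb[of j] qb by auto
      next
        case False
        then show ?thesis using j hb[of j] qb rin[of j] iq eq by (cases "j = q") auto
      qed
      then show "height m b p < height m b j" using hb[of p] pi inb by simp
    next
      assume "r < n" then show "height m b r \<le> height m b p"
        using hb[of r] hb[of p] rend eq iq pi inb by simp
    qed (use qb pi in auto)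
    then have step_d: "step_at m n p b (lower p r b)"
      unfolding step_at_def using bD asc_b by blast
    \<comment> \<open>Entries of \<open>{i..<r}\<close> are lowered twice on the way from \<open>a\<close> to \<open>lower p r b\<close>,
      but not at all on the way to \<open>c\<close>; hence two steps at \<open>i\<close> are due.\<close>
    have blc: "block m c i r"
      unfolding block_def lens using hc[of i] hc rin rend qb iq inb by auto
    define c1 where "c1 = lower i r c"
    have s1: "step_at m n i c c1"
      unfolding step_at_def c1_def using cD asc_c blc by blast
    have c1D: "c1 \<in> Dyck m n" using step_at_in_Dyck[OF s1] by simp
    have blc1: "block m c1 i r"
      unfolding c1_def by (rule block_lower_self[OF cD asc_c blc])
    have asc_c1: "ascent c1 i"
      using prev len iq inb qb by (auto simp: ascent_def c_def c1_def nth_lower)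
    have s2: "step_at m n i c1 (lower i r c1)"
      unfolding step_at_def using c1D asc_c1 blc1 by blast
    have "lower i r c1 = lower p r b"
      by (rule nth_equalityI) (use iq qb in \<open>auto simp: c1_def c_def b nth_lower\<close>)
    then have "(c, lower p r b) \<in> (tamari_step m n)\<^sup>+"
      using s1 s2 step_at_tamari_step by (metis r_into_trancl trancl_into_trancl)
    then show ?thesis using step_c step_d by blast
  next
    case False
    have "block m b p q"
      unfolding block_def lens
    proof (intro conjI allI impI)
      fix j assume j: "p < j \<and> j < q"
      then show "height m b p < height m b j"
        using hb[of p] hb[of j] qin[of j] pi inb qb by auto
    next
      assume qn: "q < n"
      have "height m a q + 1 \<le> height m a p" if "i \<le> q" "q < r"
      proof (cases "i = q")
        case True then show ?thesis using False qend[OF qn] by auto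
      next
        case False
        then have "i < q" using that by simp
        then show ?thesis using rin[of q] qin[of i] that pi qend[OF qn] by simp
      qed
      then show "height m b q \<le> height m b p"
        using hb[of p] hb[of q] qend qn pi inb by auto
    qed (use qb in auto)
    then have step_d: "step_at m n p b (lower p q b)"
      unfolding step_at_def using bD asc_b by blast
    \<comment> \<open>Blocks are nested or disjoint.\<close>
    have "r \<le> q" if "i < q"
    proof (rule ccontr)
      assume "\<not> r \<le> q"
      then show False using rin[of q] qin[of i] qend that pi qb by auto
    qed
    moreover have "height m a i + 1 \<le> height m a j" if "i < j" "j < r" for j
      using rin[OF that] by simp
    ultimately have "block m c i r"
      unfolding block_def lens using hc rin rend pi qb inb
      by (cases "i < q") auto
    then have "step_at m n i c (lower i r c)"
      unfolding step_at_def using cD asc_c by blast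
    moreover have "lower i r c = lower p q b"
      by (rule nth_equalityI) (auto simp: c_def b nth_lower)
    ultimately have "(c, lower p q b) \<in> (tamari_step m n)\<^sup>+"
      using step_at_tamari_step by (metis r_into_trancl)
    then show ?thesis using step_c step_d by blast
  qed
qed

section \<open>Lowering the first difference\<close>

definition first_diff :: "nat list \<Rightarrow> nat list \<Rightarrow> nat \<Rightarrow> bool" where
  "first_diff x y p \<longleftrightarrow> p < length x \<and> (\<forall>j<p. x ! j = y ! j) \<and> y ! p < x ! p"

lemma tamari_in_Dyck: "(x, y) \<in> tamari m n \<Longrightarrow> x \<in> Dyck m n \<and> y \<in> Dyck m n"
  by (auto simp: tamari_def)

lemma tamari_trans: "(x, y) \<in> tamari m n \<Longrightarrow> (y, z) \<in> tamari m n \<Longrightarrow> (x, z) \<in> tamari m n"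
  by (auto simp: tamari_def)

lemma tamari_antisym: "(x, y) \<in> tamari m n \<Longrightarrow> (y, x) \<in> tamari m n \<Longrightarrow> x = y"
  using partial_order_on_tamari[of m n] by (auto simp: partial_order_on_def antisym_def)

lemma step_at_tamari: "step_at m n p x y \<Longrightarrow> (x, y) \<in> tamari m n"
  using step_at_in_Dyck[of m n p x y] tamari_step_iff[of x y m n] by (auto simp: tamari_def)

lemma tamari_induct [consumes 1, case_names refl step]:
  assumes "(x, y) \<in> tamari m n"
    and "y \<in> Dyck m n \<Longrightarrow> P y"
    and "\<And>x p z. step_at m n p x z \<Longrightarrow> (z, y) \<in> tamari m n \<Longrightarrow> P z \<Longrightarrow> P x"
  shows "P x"
proof -
  have "(x, y) \<in> (tamari_step m n)\<^sup>*" and yD: "y \<in> Dyck m n"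
    using assms(1) by (auto simp: tamari_def)
  then have "(x, y) \<in> tamari m n \<and> P x"
  proof (induction rule: converse_rtrancl_induct)
    case base
    then show ?case using yD assms(2) by (simp add: tamari_def)
  next
    case (step x z)
    then obtain p where "step_at m n p x z" using tamari_step_iff by blast
    then show ?case
      using step.IH assms(3) step_at_tamari tamari_trans yD by blast
  qed
  then show ?thesis ..
qed

lemma tamari_nth_le:
  assumes "(x, y) \<in> tamari m n" "j < n"
  shows "y ! j \<le> x ! j"
  using assms(1)
proof (induction rule: tamari_induct)
  case (step x p z)
  then have "z ! j \<le> x ! j"
    using assms(2) by (auto simp: step_at_def nth_lower Dyck_iff)
  then show ?case using step.IH by linarith
qed simp

lemma first_diff_exists:
  assumes "(x, y) \<in> tamari m n" "x \<noteq> y"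
  shows "\<exists>p. first_diff x y p"
proof -
  have len: "length x = n" "length y = n"
    using tamari_in_Dyck[OF assms(1)] by (auto simp: Dyck_iff)
  then obtain j where j: "j < n \<and> x ! j \<noteq> y ! j"
    using assms(2) by (auto simp: list_eq_iff_nth_eq)
  define p where "p = (LEAST j. j < n \<and> x ! j \<noteq> y ! j)"
  have p: "p < n \<and> x ! p \<noteq> y ! p" unfolding p_def using j by (rule LeastI)
  moreover have "x ! j = y ! j" if "j < p" for j
    using that p not_less_Least[of j "\<lambda>j. j < n \<and> x ! j \<noteq> y ! j"] unfolding p_def by auto
  moreover have "y ! p < x ! p"
    using p tamari_nth_le[OF assms(1), of p] by simp
  ultimately show ?thesis unfolding first_diff_def using len by blast
qed

lemma first_diff_le: "first_diff x y p \<Longrightarrow> y ! j < x ! j \<Longrightarrow> p \<le> j"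
  unfolding first_diff_def by (metis leI less_irrefl)

text \<open>
  As \<open>x\<close> and \<open>y\<close> agree just before \<open>p\<close>, monotonicity of \<open>y\<close> gives
  \<open>x ! (p - 1) = y ! (p - 1) \<le> y ! p < x ! p\<close>.
\<close>

lemma first_diff_ascent:
  assumes "(x, y) \<in> tamari m n" "first_diff x y p"
  shows "ascent x p"
proof -
  have D: "x \<in> Dyck m n" "y \<in> Dyck m n" using tamari_in_Dyck[OF assms(1)] by auto
  have p: "p < n" using assms(2) D by (auto simp: first_diff_def Dyck_iff)
  have "p \<noteq> 0"
    using D(1) assms(2) p by (cases p) (auto simp: Dyck_iff first_diff_def)
  moreover have "y ! (p - 1) \<le> y ! p" using Dyck_mono[OF D(2), of "p - 1" p] p by simp
  ultimately show ?thesis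
    using assms(2) by (auto simp: first_diff_def ascent_def)
qed

lemma first_diff_step:
  assumes "step_at m n i x z" "(z, y) \<in> tamari m n" "first_diff x y p"
  shows "i = p \<or> p < i \<and> first_diff z y p"
proof -
  have "y ! i < x ! i"
    using step_at_nth_at[OF assms(1)] tamari_nth_le[OF assms(2), of i] by linarith
  then have "p \<le> i" using first_diff_le assms(3) by blast
  moreover have "first_diff z y p" if "p < i"
    using assms(1,3) that step_at_nth_before[OF assms(1)]
    by (auto simp: first_diff_def step_at_def)
  ultimately show ?thesis by linarith
qed

text \<open>
  By induction along a chain from \<open>x\<close> to \<open>y\<close>: if its first step is not at \<open>p\<close>, it is at
  a later position \<open>i\<close>, and \<open>p\<close> is still the first difference after it. The induction
  hypothesis puts \<open>S\<^sub>p (S\<^sub>i x)\<close> below \<open>y\<close>, and \<open>S\<^sub>p x\<close> is below that element by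
  \<open>step_exchange\<close>.
\<close>

lemma lower_first_diff:
  assumes "(x, y) \<in> tamari m n" "first_diff x y p" "step_at m n p x c"
  shows "(c, y) \<in> tamari m n"
  using assms
proof (induction arbitrary: c rule: tamari_induct)
  case refl
  then show ?case by (simp add: first_diff_def)
next
  case (step x i z)
  consider "i = p" | "p < i" "first_diff z y p"
    using first_diff_step[OF step.hyps step.prems(1)] by blast
  then show ?case
  proof cases
    case 1
    then show ?thesis using step step_at_unique by blast
  next
    case 2
    have "ascent x p" using step.prems(2) by (simp add: step_at_def)
    then obtain c' d where *: "step_at m n p x c'" "step_at m n p z d"
        "(c', d) \<in> (tamari_step m n)\<^sup>+"
      using step_exchange[OF step.hyps(1) 2(1)] by blast
    have "(c, d) \<in> (tamari_step m n)\<^sup>+" using * step.prems(2) step_at_unique by blast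
    then have "(c, d) \<in> tamari m n"
      using step_at_in_Dyck[OF *(2)] step_at_in_Dyck[OF step.prems(2)]
      by (simp add: tamari_def)
    then show ?thesis
      using step.IH[OF 2(2) *(2)] tamari_trans by blast
  qed
qed

section \<open>Covering relations\<close>

lemma tamari_trancl_neq: "(x, y) \<in> (tamari_step m n)\<^sup>+ \<Longrightarrow> x \<noteq> y"
proof
  assume "(x, y) \<in> (tamari_step m n)\<^sup>+" "x = y"
  then obtain z where z: "(x, z) \<in> tamari_step m n" "(z, x) \<in> (tamari_step m n)\<^sup>*"
    by (metis tranclD)
  obtain p where p: "step_at m n p x z" using z(1) tamari_step_iff by blast
  have "(z, x) \<in> tamari m n" using z step_at_in_Dyck[OF p] by (simp add: tamari_def)
  then have "x = z" using tamari_antisym step_at_tamari[OF p] by blast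
  then show False using step_at_nth_at[OF p] by simp
qed

lemma tamari_first_step:
  assumes "(x, y) \<in> tamari m n" "x \<noteq> y"
  shows "\<exists>p z. step_at m n p x z \<and> (z, y) \<in> tamari m n"
  using assms by (induction rule: tamari_induct) auto

lemma step_at_neq: "step_at m n p x y \<Longrightarrow> x \<noteq> y"
  using step_at_nth_at(1)[of m n p x y] by auto

lemma first_diff_step_at: "step_at m n p x y \<Longrightarrow> first_diff x y p"
  using step_at_nth_at[of m n p x y] step_at_nth_before[of m n p x y]
  by (auto simp: first_diff_def step_at_def Dyck_iff)

text \<open>
  Let \<open>y = S\<^sub>p x\<close>, and suppose that a chain from \<open>x\<close> to \<open>y\<close> starts with a step to \<open>w\<close> at
  some position other than \<open>p\<close>. Then \<open>S\<^sub>p w \<le> y\<close> by \<open>lower_first_diff\<close>, but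
  \<open>y = S\<^sub>p x\<close> is strictly below \<open>S\<^sub>p w\<close> by \<open>step_exchange\<close>. So every chain from \<open>x\<close>
  to \<open>y\<close> starts with the step at \<open>p\<close>, and already arrives there.
\<close>

lemma covers_tamari_iff: "covers (tamari m n) x y \<longleftrightarrow> (\<exists>p. step_at m n p x y)"
proof
  assume cov: "covers (tamari m n) x y"
  then obtain p z where z: "step_at m n p x z" "(z, y) \<in> tamari m n"
    using tamari_first_step unfolding covers_def by blast
  then have "z = y"
    using cov step_at_tamari[OF z(1)] step_at_neq[OF z(1)] unfolding covers_def by blast
  then show "\<exists>p. step_at m n p x y" using z by blast
next
  assume "\<exists>p. step_at m n p x y"
  then obtain p where p: "step_at m n p x y" ..
  have "z = y" if xz: "(x, z) \<in> tamari m n" "x \<noteq> z" and zy: "(z, y) \<in> tamari m n" for z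
  proof -
    obtain i w where w: "step_at m n i x w" "(w, z) \<in> tamari m n"
      using tamari_first_step[OF xz] by blast
    have wy: "(w, y) \<in> tamari m n" using w(2) zy tamari_trans by blast
    consider "i = p" | "p < i" "first_diff w y p"
      using first_diff_step[OF w(1) wy first_diff_step_at[OF p]] by blast
    then show ?thesis
    proof cases
      case 1
      then have "w = y" using w(1) p step_at_unique by blast
      then show ?thesis using w(2) zy tamari_antisym by blast
    next
      case 2
      obtain c d where *: "step_at m n p x c" "step_at m n p w d" "(c, d) \<in> (tamari_step m n)\<^sup>+"
        using step_exchange[OF w(1) 2(1)] p by (auto simp: step_at_def)
      have "c = y" using * p step_at_unique by blast
      have "(d, y) \<in> tamari m n" by (rule lower_first_diff[OF wy 2(2) *(2)])
      moreover have "(y, d) \<in> tamari m n"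
        using *(3) \<open>c = y\<close> step_at_in_Dyck[OF *(2)] step_at_in_Dyck[OF p]
        by (simp add: tamari_def)
      ultimately have "d = y" using tamari_antisym by blast
      then show ?thesis using tamari_trancl_neq[OF *(3)] \<open>c = y\<close> by simp
    qed
  qed
  then show "covers (tamari m n) x y"
    unfolding covers_def using step_at_tamari[OF p] step_at_neq[OF p] by blast
qed

lemma tamari_label_step_at:
  assumes "step_at m n p x y"
  shows "tamari_label n x y = (Suc p, x ! p)"
proof -
  have "Min {i \<in> {1..n}. x\<llangle>i\<rrangle> \<noteq> y\<llangle>i\<rrangle>} = Suc p"
  proof (rule Min_eqI)
    show "Suc p \<le> i" if "i \<in> {i \<in> {1..n}. x\<llangle>i\<rrangle> \<noteq> y\<llangle>i\<rrangle>}" for i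
      using that step_at_nth_before[OF assms, of "i - 1"]
      by (cases "i - 1 < p") auto
    show "Suc p \<in> {i \<in> {1..n}. x\<llangle>i\<rrangle> \<noteq> y\<llangle>i\<rrangle>}"
      using step_at_nth_at[OF assms] by auto
  qed simp
  then show ?thesis by (simp add: tamari_label_def)
qed

section \<open>Maximal chains\<close>

lemma maximal_chain_single [simp]: "maximal_chain r x y [z] \<longleftrightarrow> z = x \<and> z = y"
  by (auto simp: maximal_chain_def)

lemma maximal_chain_Nil [simp]: "\<not> maximal_chain r x y []"
  by (simp add: maximal_chain_def)

lemma maximal_chain_Cons [simp]:
  "maximal_chain r x y (u # v # c) \<longleftrightarrow> u = x \<and> covers r x v \<and> maximal_chain r v y (v # c)"
proof -
  have "(\<forall>i. P i) \<longleftrightarrow> P 0 \<and> (\<forall>i. P (Suc i))" for P :: "nat \<Rightarrow> bool"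
    by (metis not0_implies_Suc)
  note split = this[of "\<lambda>i. Suc i < length (u # v # c) \<longrightarrow> covers r ((u # v # c) ! i) ((u # v # c) ! Suc i)"]
  show ?thesis
    unfolding maximal_chain_def split by auto
qed

lemma maximal_chain_snoc [simp]:
  "maximal_chain r x y (c @ [u, v]) \<longleftrightarrow> v = y \<and> covers r u y \<and> maximal_chain r x u (c @ [u])"
  by (induction c arbitrary: x rule: induct_list012) auto

lemma labels_single [simp]: "labels lam [x] = []"
  by (simp add: labels_def)

lemma labels_Cons [simp]: "labels lam (u # v # c) = lam u v # labels lam (v # c)"
proof -
  have "[0..<Suc (length c)] = 0 # map Suc [0..<length c]"
    by (simp add: upt_conv_Cons map_Suc_upt del: upt_Suc)
  then show ?thesis
    by (simp add: labels_def del: upt_Suc)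
qed

lemma labels_snoc [simp]: "labels lam (c @ [u, v]) = labels lam (c @ [u]) @ [lam u v]"
  by (induction c rule: induct_list012) auto

lemma tamari_chain_le:
  assumes "maximal_chain (tamari m n) x y c" "x \<in> Dyck m n"
  shows "(x, y) \<in> tamari m n"
  using assms
proof (induction c arbitrary: x rule: induct_list012)
  case (2 z)
  then show ?case by (auto simp: tamari_def)
next
  case (3 u v c)
  then have cov: "covers (tamari m n) x v" and c: "maximal_chain (tamari m n) v y (v # c)"
    by auto
  have xv: "(x, v) \<in> tamari m n" using cov by (simp add: covers_def)
  then show ?case
    using "3.IH"(2)[OF c] tamari_in_Dyck[OF xv] tamari_trans by blast
qed simp

lemma maximal_chain_endpoints:
  "maximal_chain r x y c \<Longrightarrow> c \<noteq> [] \<and> hd c = x \<and> last c = y"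
  by (simp add: maximal_chain_def)

lemma tamari_chain_ConsE:
  assumes "maximal_chain (tamari m n) x y c" "x \<in> Dyck m n" "x \<noteq> y"
  obtains p z c' where "c = x # z # c'" "step_at m n p x z"
    "maximal_chain (tamari m n) z y (z # c')" "(z, y) \<in> tamari m n"
    "labels (tamari_label n) c = (Suc p, x ! p) # labels (tamari_label n) (z # c')"
proof (cases c rule: remdups_adj.cases)
  case 1
  then show ?thesis using assms(1) by auto
next
  case (2 z)
  then show ?thesis using assms(1,3) by auto
next
  case (3 u z c')
  then have cov: "covers (tamari m n) x z" and c: "maximal_chain (tamari m n) z y (z # c')"
    and u: "u = x"
    using assms(1) by auto
  obtain p where p: "step_at m n p x z" using cov covers_tamari_iff by blast
  have "z \<in> Dyck m n" using step_at_in_Dyck[OF p] by simp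
  then show ?thesis
    using that[OF _ p c tamari_chain_le[OF c]] 3 u tamari_label_step_at[OF p] by simp
qed

lemma tamari_chain_trivial:
  assumes "maximal_chain (tamari m n) x x c"
  shows "c = [x]"
proof (cases c rule: remdups_adj.cases)
  case (3 u z c')
  then have cov: "covers (tamari m n) x z" and c: "maximal_chain (tamari m n) z x (z # c')"
    using assms by auto
  have xz: "(x, z) \<in> tamari m n" "x \<noteq> z" using cov by (auto simp: covers_def)
  then show ?thesis
    using tamari_chain_le[OF c] tamari_in_Dyck[OF xz(1)] tamari_antisym by blast
qed (use assms in auto)

section \<open>Label sequences\<close>

text \<open>
  A step at \<open>p\<close> anywhere in the chain starts from an entry between those of \<open>x\<close> and \<open>y\<close> and
  strictly decreases it. In particular \<open>p\<close> is not before the first difference of \<open>x\<close>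
  and \<open>y\<close>.
\<close>

lemma label_in_chain:
  assumes "maximal_chain (tamari m n) x y c" "x \<in> Dyck m n"
    and "(i, u) \<in> set (labels (tamari_label n) c)"
  shows "\<exists>p<n. i = Suc p \<and> y ! p < u \<and> u \<le> x ! p"
  using assms
proof (induction c arbitrary: x rule: induct_list012)
  case (3 v w c)
  then have ne: "x \<noteq> y" using tamari_chain_trivial by fastforce
  obtain p z c' where *: "v # w # c = x # z # c'" "step_at m n p x z"
    "maximal_chain (tamari m n) z y (z # c')" "(z, y) \<in> tamari m n"
    "labels (tamari_label n) (v # w # c) = (Suc p, x ! p) # labels (tamari_label n) (z # c')"
    using tamari_chain_ConsE[OF 3(3,4) ne] .
  have zD: "z \<in> Dyck m n" using step_at_in_Dyck[OF *(2)] by simp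
  have le: "z ! j \<le> x ! j" if "j < n" for j
    using tamari_nth_le[OF step_at_tamari[OF *(2)] that] .
  consider "i = Suc p" "u = x ! p" | "(i, u) \<in> set (labels (tamari_label n) (w # c))"
    using 3(5) * by auto
  then show ?case
  proof cases
    case 1
    then show ?thesis
      using step_at_nth_at[OF *(2)] tamari_nth_le[OF *(4), of p] by force
  next
    case 2
    then obtain j where j: "j < n" "i = Suc j" "y ! j < u" "u \<le> z ! j"
      using "3.IH"(2)[of z] * zD by auto
    then show ?thesis using le[of j] by auto
  qed
qed auto

text \<open>
  As steps before \<open>p\<close> are excluded, the entry at \<open>p\<close> first changes by a step at \<open>p\<close>
  itself, and it still has its original value then.
\<close>

lemma first_diff_label_in_chain:
  assumes "maximal_chain (tamari m n) x y c" "x \<in> Dyck m n" "first_diff x y p"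
  shows "(Suc p, x ! p) \<in> set (labels (tamari_label n) c)"
  using assms
proof (induction c arbitrary: x rule: induct_list012)
  case (2 z)
  then show ?case by (auto simp: first_diff_def)
next
  case (3 v w c)
  have ne: "x \<noteq> y" using 3(5) by (auto simp: first_diff_def)
  obtain i z c' where *: "v # w # c = x # z # c'" "step_at m n i x z"
    "maximal_chain (tamari m n) z y (z # c')" "(z, y) \<in> tamari m n"
    "labels (tamari_label n) (v # w # c) = (Suc i, x ! i) # labels (tamari_label n) (z # c')"
    using tamari_chain_ConsE[OF 3(3,4) ne] .
  consider "i = p" | "p < i" "first_diff z y p"
    using first_diff_step[OF *(2,4) 3(5)] by blast
  then show ?case
  proof cases
    case 1
    then show ?thesis unfolding *(5) by simp
  next
    case 2
    have "(Suc p, z ! p) \<in> set (labels (tamari_label n) (w # c))"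
      using "3.IH"(2)[of z] * 2(2) step_at_in_Dyck[OF *(2)] by auto
    then show ?thesis
      unfolding *(5) using *(1) step_at_nth_before[OF *(2) 2(1)] by simp
  qed
qed simp

section \<open>Rising chains\<close>

lemma rising_Cons:
  "rising s lam (u # v # c) \<longleftrightarrow>
     (\<forall>l \<in> set (labels lam (v # c)). (lam u v, l) \<in> s \<and> lam u v \<noteq> l) \<and> rising s lam (v # c)"
  by (simp add: rising_def)

text \<open>
  The measure for the recursive construction of rising chains.
\<close>

lemma sum_list_step_at:
  assumes "step_at m n p x y"
  shows "sum_list y < sum_list x"
proof -
  have len: "length x = n" "length y = n"
    using step_at_in_Dyck[OF assms] by (auto simp: Dyck_iff)
  have "(\<Sum>j = 0..<n. y ! j) < (\<Sum>j = 0..<n. x ! j)"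
  proof (rule sum_strict_mono_ex1)
    show "\<forall>j\<in>{0..<n}. y ! j \<le> x ! j"
      using tamari_nth_le[OF step_at_tamari[OF assms]] by auto
    show "\<exists>j\<in>{0..<n}. y ! j < x ! j"
      using step_at_nth_at[OF assms] by auto
  qed simp
  then show ?thesis by (simp add: sum_list_sum_nth len)
qed

lemma rising_chain_exists:
  assumes "(x, y) \<in> tamari m n"
  shows "\<exists>c. maximal_chain (tamari m n) x y c \<and> rising label_order (tamari_label n) c"
  using assms
proof (induction "sum_list x" arbitrary: x rule: less_induct)
  case less
  show ?case
  proof (cases "x = y")
    case True
    then have "maximal_chain (tamari m n) x y [x] \<and> rising label_order (tamari_label n) [x]"
      by (simp add: rising_def)
    then show ?thesis ..
  next
    case False
    then obtain p where p: "first_diff x y p" using first_diff_exists less.prems by blast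
    obtain z where z: "step_at m n p x z"
      using step_at_exists first_diff_ascent[OF less.prems p] tamari_in_Dyck[OF less.prems]
      by blast
    have zy: "(z, y) \<in> tamari m n" by (rule lower_first_diff[OF less.prems p z])
    obtain c where c: "maximal_chain (tamari m n) z y c" "rising label_order (tamari_label n) c"
      using less.hyps[OF sum_list_step_at[OF z] zy] by blast
    obtain c' where c': "c = z # c'"
      using c(1) maximal_chain_endpoints[OF c(1)] by (cases c) auto
    have zD: "z \<in> Dyck m n" using step_at_in_Dyck[OF z] by simp
    \<comment> \<open>Later labels are at positions from \<open>p\<close> on, and those at \<open>p\<close> have smaller entries;
      both count as larger in \<open>label_order\<close>.\<close>
    have "((Suc p, x ! p), l) \<in> label_order \<and> (Suc p, x ! p) \<noteq> l"
      if l: "l \<in> set (labels (tamari_label n) c)" for l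
    proof -
      obtain i u where iu: "l = (i, u)" by (cases l)
      obtain j where j: "j < n" "i = Suc j" "y ! j < u" "u \<le> z ! j"
        using label_in_chain[OF c(1) zD l[unfolded iu]] by blast
      have "z ! j \<le> x ! j" using tamari_nth_le[OF step_at_tamari[OF z] j(1)] .
      then have "p \<le> j" using j first_diff_le[OF p, of j] by linarith
      moreover have "u < x ! p" if "j = p" using step_at_nth_at[OF z] j that by simp
      ultimately show ?thesis using iu j by (cases "j = p") (auto simp: label_order_def)
    qed
    then have "rising label_order (tamari_label n) (x # c)"
      using c(2) unfolding c' rising_Cons tamari_label_step_at[OF z] by blast
    moreover have "maximal_chain (tamari m n) x y (x # c)"
      using c(1) z covers_tamari_iff unfolding c' by auto
    ultimately show ?thesis by blast
  qed
qed

text \<open>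
  The first label of a rising chain is its least, so its first step is at the first
  difference \<open>p\<close>. The first step of \<open>d\<close> is then either the same one, or it is at a later
  position and has a larger label. Two rising chains cannot both precede each other
  strictly, so this also yields uniqueness.
\<close>

lemma rising_chain_lex_first:
  assumes "maximal_chain (tamari m n) x y c" "rising label_order (tamari_label n) c"
    and "maximal_chain (tamari m n) x y d" "x \<in> Dyck m n"
  shows "c = d \<or>
    (labels (tamari_label n) c, labels (tamari_label n) d) \<in> lexord (label_order - Id)"
  using assms
proof (induction c arbitrary: x d rule: induct_list012)
  case (2 z)
  then show ?case using tamari_chain_trivial by auto
next
  case (3 v w c)
  then have xy: "(x, y) \<in> tamari m n" and ne: "x \<noteq> y"
    using tamari_chain_le tamari_chain_trivial by blast+
  obtain p where p: "first_diff x y p" using first_diff_exists[OF xy ne] ..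
  obtain i z c' where c: "v # w # c = x # z # c'" "step_at m n i x z"
    "maximal_chain (tamari m n) z y (z # c')" "(z, y) \<in> tamari m n"
    "labels (tamari_label n) (v # w # c) = (Suc i, x ! i) # labels (tamari_label n) (z # c')"
    using tamari_chain_ConsE[OF "3.prems"(1,4) ne] .
  obtain j z' d' where d: "d = x # z' # d'" "step_at m n j x z'"
    "maximal_chain (tamari m n) z' y (z' # d')" "(z', y) \<in> tamari m n"
    "labels (tamari_label n) d = (Suc j, x ! j) # labels (tamari_label n) (z' # d')"
    using tamari_chain_ConsE[OF "3.prems"(3,4) ne] .
  have wz: "v = x" "w = z" "c = c'" using c(1) by auto
  have ris: "rising label_order (tamari_label n) (w # c)"
    and lab: "\<forall>l \<in> set (labels (tamari_label n) (z # c')). ((Suc i, x ! i), l) \<in> label_order"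
    using "3.prems"(2) tamari_label_step_at[OF c(2)] unfolding c(1) rising_Cons wz by auto
  have "i = p"
  proof (rule ccontr)
    assume "i \<noteq> p"
    then have "p < i" using first_diff_step[OF c(2,4) p] by blast
    moreover have "(Suc p, x ! p) \<in> set (labels (tamari_label n) (v # w # c))"
      by (rule first_diff_label_in_chain[OF "3.prems"(1,4) p])
    ultimately show False using lab unfolding c(5) by (auto simp: label_order_def)
  qed
  consider "j = p" | "p < j" using first_diff_step[OF d(2,4) p] by blast
  then show ?case
  proof cases
    case 1
    then have "z' = z" using c(2) d(2) \<open>i = p\<close> step_at_unique by blast
    moreover have "z \<in> Dyck m n" using step_at_in_Dyck[OF c(2)] by simp
    ultimately have "w # c = z' # d' \<or> (labels (tamari_label n) (w # c),
        labels (tamari_label n) (z' # d')) \<in> lexord (label_order - Id)"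
      using "3.IH"(2)[of z "z' # d'"] c(3) d(3) ris wz by blast
    then show ?thesis
      unfolding c(5) d(5) using d(1) wz 1 \<open>i = p\<close> by auto
  next
    case 2
    then show ?thesis
      unfolding c(5) d(5) using \<open>i = p\<close> by (simp add: label_order_def)
  qed
qed simp

section \<open>Falling chains\<close>

lemma falling_snoc:
  "falling s lam (c @ [u, v]) \<longleftrightarrow>
     falling s lam (c @ [u]) \<and> (\<forall>l \<in> set (labels lam (c @ [u])). (lam u v, l) \<in> s)"
  by (simp add: falling_def sorted_wrt_append)

text \<open>
  The lowered block can be read off from the result, since lowering preserves its end.
\<close>

lemma step_at_inj:
  assumes "step_at m n p u y" "step_at m n p v y"
  shows "u = v"
proof -
  obtain q where u: "u \<in> Dyck m n" "ascent u p" "block m u p q" "y = lower p q u"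
    using assms(1) unfolding step_at_def by blast
  obtain r where v: "v \<in> Dyck m n" "ascent v p" "block m v p r" "y = lower p r v"
    using assms(2) unfolding step_at_def by blast
  have "block m y p q" using block_lower_self[OF u(1-3)] u(4) by simp
  moreover have "block m y p r" using block_lower_self[OF v(1-3)] v(4) by simp
  ultimately have qr: "r = q" using block_unique by blast
  have len: "length u = n" "length v = n" using u(1) v(1) by (auto simp: Dyck_iff)
  show ?thesis
  proof (rule nth_equalityI)
    fix j assume "j < length u"
    then have j: "j < n" using len by simp
    have "lower p q u ! j = lower p q v ! j" using u(4) v(4) qr by simp
    then show "u ! j = v ! j"
      using ascent_pos[OF u(1,2) _ j] ascent_pos[OF v(1,2) _ j] j len
      by (auto simp: nth_lower split: if_splits)
  qed (simp add: len)
qed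

text \<open>
  The last label of a falling chain is its least, and the least position that occurs is the
  first difference.
\<close>

lemma falling_chain_last_step:
  assumes c: "maximal_chain (tamari m n) x y (c @ [u, y])"
    and fall: "falling label_order (tamari_label n) (c @ [u, y])"
    and x: "x \<in> Dyck m n" and p: "step_at m n p u y"
  shows "first_diff x y p"
proof -
  have "x \<noteq> y" using c tamari_chain_trivial by fastforce
  then obtain j where j: "first_diff x y j"
    using first_diff_exists tamari_chain_le[OF c x] by blast
  have last: "tamari_label n u y = (Suc p, u ! p)" by (rule tamari_label_step_at[OF p])
  then have "(Suc p, u ! p) \<in> set (labels (tamari_label n) (c @ [u, y]))" by simp
  then have "y ! p < x ! p" using label_in_chain[OF c x] by fastforce
  then have "j \<le> p" by (rule first_diff_le[OF j])
  moreover have "(Suc j, x ! j) \<in> set (labels (tamari_label n) (c @ [u, y]))"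
    by (rule first_diff_label_in_chain[OF c x j])
  then have "p \<le> j"
    using fall unfolding falling_snoc labels_snoc last by (auto simp: label_order_def)
  ultimately show ?thesis using j by simp
qed

lemma falling_chain_unique:
  assumes "maximal_chain (tamari m n) x y c" "falling label_order (tamari_label n) c"
    and "maximal_chain (tamari m n) x y d" "falling label_order (tamari_label n) d"
    and "x \<in> Dyck m n"
  shows "c = d"
  using assms(1-4)
proof (induction c arbitrary: y d rule: rev_induct)
  case (snoc v c)
  show ?case
  proof (cases "x = y")
    case True
    then show ?thesis using snoc.prems tamari_chain_trivial by metis
  next
    case False
    have snoc_form: "\<exists>e' u. e = e' @ [u, y]" if "maximal_chain (tamari m n) x y e" for e
    proof (cases e rule: rev_cases)
      case (snoc e1 w)
      then show ?thesis using that False by (cases e1 rule: rev_cases) auto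
    qed (use that in auto)
    obtain c' u where c': "c = c' @ [u]" "v = y"
      using snoc_form[OF snoc.prems(1)] by (auto simp: append_eq_append_conv2 Cons_eq_append_conv)
    obtain d' u' where d': "d = d' @ [u', y]"
      using snoc_form[OF snoc.prems(3)] by blast
    have cc: "maximal_chain (tamari m n) x y (c' @ [u, y])"
        "falling label_order (tamari_label n) (c' @ [u, y])"
      using snoc.prems(1,2) c' by auto
    note dd = snoc.prems(3,4)[unfolded d']
    obtain p where p: "step_at m n p u y" using cc(1) covers_tamari_iff by auto
    obtain q where q: "step_at m n q u' y" using dd(1) covers_tamari_iff by auto
    have "first_diff x y p" "first_diff x y q"
      using falling_chain_last_step cc dd p q assms(5) by blast+
    then have "p = q"
      by (metis first_diff_def first_diff_le order_antisym)
    then have "u = u'" using p q step_at_inj by blast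
    have "c' @ [u] = d' @ [u]"
    proof (rule snoc.IH[unfolded c'(1)])
      show "maximal_chain (tamari m n) x u (c' @ [u])" "maximal_chain (tamari m n) x u (d' @ [u])"
        using cc(1) dd(1) \<open>u = u'\<close> by auto
      show "falling label_order (tamari_label n) (c' @ [u])"
           "falling label_order (tamari_label n) (d' @ [u])"
        using cc(2) dd(2) \<open>u = u'\<close> unfolding falling_snoc by auto
    qed
    then show ?thesis using c' d' \<open>u = u'\<close> by simp
  qed
qed simp

section \<open>The labeling is an EL-labeling\<close>

theorem theorem3p2:
  fixes m n :: nat
  assumes "m > 0" and "n > 0"
  shows "EL_labeling (Dyck m n) (tamari m n) label_order (tamari_label n) \<and>
    (\<forall>x y. (x, y) \<in> tamari m n \<longrightarrow>
      (\<exists>\<^sub>\<le>\<^sub>1c. maximal_chain (tamari m n) x y c \<and> falling label_order (tamari_label n) c))"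
proof (intro conjI allI impI)
  let ?rising = "\<lambda>x y c. maximal_chain (tamari m n) x y c \<and> rising label_order (tamari_label n) c"
  have "asym (label_order - Id)"
    by (auto simp: asym_on_def label_order_def)
  then have asym: "(qs, ps) \<notin> lexord (label_order - Id)" if "(ps, qs) \<in> lexord (label_order - Id)"
    for ps qs using lexord_asymmetric that by blast
  have "c = d" if "(x, y) \<in> tamari m n" "?rising x y c" "?rising x y d" for x y c d
    using rising_chain_lex_first[of m n x y] tamari_in_Dyck[OF that(1)] that(2,3) asym by metis
  then have "\<exists>!c. ?rising x y c" if "(x, y) \<in> tamari m n" for x y
    using rising_chain_exists[OF that] that by blast
  moreover have "lex_le label_order (labels (tamari_label n) c) (labels (tamari_label n) d)"
    if "(x, y) \<in> tamari m n" "?rising x y c" "maximal_chain (tamari m n) x y d" for x y c d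
    using rising_chain_lex_first[of m n x y c d] tamari_in_Dyck[OF that(1)] that(2,3)
    unfolding lex_le_def by auto
  ultimately show "EL_labeling (Dyck m n) (tamari m n) label_order (tamari_label n)"
    unfolding EL_labeling_def
    using partial_order_on_tamari partial_order_on_label_order by blast
next
  fix x y assume "(x, y) \<in> tamari m n"
  then show "\<exists>\<^sub>\<le>\<^sub>1c. maximal_chain (tamari m n) x y c \<and> falling label_order (tamari_label n) c"
    unfolding Uniq_def using falling_chain_unique tamari_in_Dyck by blast
qed

end
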